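(* Let $X$ be a uniformly smooth Banach space, let $Y$ be an arbitrary Banach space, and let $X_1$ be a one-complemented subspace of $X$. If $(X,Y)$ has the pointwise BPB property, then so does the pair $(X_1,Y)$. Moreover, $\tilde\eta(X,Y)(\varepsilon)\leq \tilde\eta(X_1,Y)(\varepsilon)$ for every $\varepsilon\in (0,1)$.
   Context: Banach spaces are over $\mathbb{K}$, where $\mathbb{K}=\mathbb{R}$ or $\mathbb{K}=\mathbb{C}$. $\mathcal{L}(X,Y)$ is the Banach space of bounded linear operators from $X$ to $Y$; $S_Z$ denotes the unit sphere of a Banach space $Z$. A pair $(X,Y)$ of Banach spaces has the pointwise Bishop-Phelps-Bollob\'as property (pointwise BPB property) if for every $\varepsilon>0$ there is $\eta>0$ such that whenever $T\in\mathcal{L}(X,Y)$ with $\|T\|=1$ and $x_0\in S_X$ satisfy $\|T(x_0)\|>1-\eta$, there is $S\in\mathcal{L}(X,Y)$ with $\|S\|=1$, $\|S(x_0)\|=1$ and $\|S-T\|<\varepsilon$. For $\varepsilon\in(0,1)$, the modulus $\tilde\eta(X,Y)(\varepsilon)\in[0,+\infty]$ is the supremum of the set consisting of $0$ and all $\rho>0$ such that for all $T\in S_{\mathcal{L}(X,Y)}$ and $x_0\in S_X$ with $\|T(x_0)\|>1-\rho$ there is $S\in S_{\mathcal{L}(X,Y)}$ with $\|S(x_0)\|=1$ and $\|S-T\|<\varepsilon$. A subspace $X_1$ of $X$ is one-complemented if it is the range of a norm-one projection on $X$. Uniformly smooth means $\lim_{t\to0^+}\rho_X(t)/t=0$, where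 $\rho_X(t)=\sup\{\frac{\|x+y\|+\|x-y\|-2}{2}: \|x\|=1,\ \|y\|\leq t\}$ for $0<t\leq 1$. *)

theory Defs
  imports "HOL-Analysis.Analysis"
begin

text \<open>
  The scalar field is \<open>\<real>\<close> or \<open>\<complex>\<close>. The norm is that of
  \<^class>\<open>real_normed_field\<close>; a multiplicative norm extending the absolute value of the reals is
  unique on \<open>\<real>\<close> and on \<open>\<complex>\<close>, so up to isometric isomorphism the models of the class are exactly
  \<^typ>\<open>real\<close> and \<^typ>\<open>complex\<close>.
\<close>

class real_or_complex = real_normed_field +
  assumes real_or_complex:
    "(\<forall>z. \<exists>a. z = a *\<^sub>R 1) \<or>
     (\<exists>i. i * i = - 1 \<and> (\<forall>z. \<exists>a b. z = a *\<^sub>R 1 + b *\<^sub>R i))"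

instance real :: real_or_complex
  by standard auto

instance complex :: real_or_complex
proof
  have "\<exists>a b. z = a *\<^sub>R 1 + b *\<^sub>R \<i>" for z
    by (rule exI[of _ "Re z"], rule exI[of _ "Im z"]) (simp add: complex_eq_iff)
  then show "(\<forall>z::complex. \<exists>a. z = a *\<^sub>R 1) \<or>
     (\<exists>i::complex. i * i = - 1 \<and> (\<forall>z. \<exists>a b. z = a *\<^sub>R 1 + b *\<^sub>R i))"
    by (intro disjI2 exI[of _ \<i>]) auto
qed

text \<open>
  A Banach space over \<open>'k\<close>: the class \<^class>\<open>banach\<close> provides the complete norm and the underlying
  real vector space, \<open>scale\<close> the multiplication by scalars of \<open>'k\<close>.
\<close>

locale banach_over = vector_space scale
  for scale :: "'k::real_or_complex \<Rightarrow> 'a::banach \<Rightarrow> 'a" +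
  assumes scale_of_real: "scale (of_real r) x = r *\<^sub>R x"
    and norm_scale: "norm (scale c x) = norm c * norm x"

lemma banach_over_real: "banach_over (scaleR :: real \<Rightarrow> 'a::banach \<Rightarrow> 'a)"
  by unfold_locales (auto simp: algebra_simps)

lemma banach_over_complex: "banach_over ((*) :: complex \<Rightarrow> complex \<Rightarrow> complex)"
  by unfold_locales (auto simp: algebra_simps norm_mult scaleR_conv_of_real)

text \<open>
  The bounded linear operators from a subspace \<open>V\<close> of the first space to the whole second space.
  They are represented by total functions that vanish outside \<open>V\<close>, so that an operator is
  determined by its values on \<open>V\<close> and sums and differences are pointwise.
\<close>

definition bounded_operators ::
    "('k \<Rightarrow> 'a \<Rightarrow> 'a) \<Rightarrow> 'a set \<Rightarrow> ('k \<Rightarrow> 'b \<Rightarrow> 'b) \<Rightarrow>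
     ('a::real_normed_vector \<Rightarrow> 'b::real_normed_vector) set" where
  "bounded_operators sX V sY =
    {T. (\<forall>x\<in>V. \<forall>y\<in>V. T (x + y) = T x + T y) \<and>
        (\<forall>c. \<forall>x\<in>V. T (sX c x) = sY c (T x)) \<and>
        (\<exists>B. \<forall>x\<in>V. norm (T x) \<le> B * norm x) \<and>
        (\<forall>x. x \<notin> V \<longrightarrow> T x = 0)}"

lemma bounded_operators_real_UNIV:
  "bounded_operators scaleR UNIV scaleR = {T. bounded_linear T}"
  unfolding bounded_operators_def bounded_linear_def bounded_linear_axioms_def linear_iff
  by (auto simp: mult.commute)

text \<open>The operator norm on \<open>V\<close>, relativizing \<^const>\<open>onorm\<close>.\<close>

definition onorm_on ::
    "'a::real_normed_vector set \<Rightarrow> ('a \<Rightarrow> 'b::real_normed_vector) \<Rightarrow> real" where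
  "onorm_on V T = (SUP x\<in>V. norm (T x) / norm x)"

lemma onorm_on_UNIV: "onorm_on UNIV = onorm"
  by (simp add: onorm_on_def onorm_def fun_eq_iff)

definition operator_sphere ::
    "('k \<Rightarrow> 'a \<Rightarrow> 'a) \<Rightarrow> 'a set \<Rightarrow> ('k \<Rightarrow> 'b \<Rightarrow> 'b) \<Rightarrow>
     ('a::real_normed_vector \<Rightarrow> 'b::real_normed_vector) set" where
  "operator_sphere sX V sY = {T \<in> bounded_operators sX V sY. onorm_on V T = 1}"

text \<open>
  \<open>\<rho>\<close> is admissible for \<open>\<epsilon>\<close> in the pointwise Bishop-Phelps-Bollobas property of the pair
  formed by \<open>V\<close> and the whole second space.
\<close>

definition pointwise_BPB_admissible ::
    "('k \<Rightarrow> 'a::real_normed_vector \<Rightarrow> 'a) \<Rightarrow> 'a set \<Rightarrow>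
     ('k \<Rightarrow> 'b::real_normed_vector \<Rightarrow> 'b) \<Rightarrow> real \<Rightarrow> real \<Rightarrow> bool" where
  "pointwise_BPB_admissible sX V sY \<epsilon> \<rho> \<longleftrightarrow>
    (\<forall>T \<in> operator_sphere sX V sY. \<forall>x0 \<in> V. norm x0 = 1 \<and> norm (T x0) > 1 - \<rho> \<longrightarrow>
      (\<exists>S \<in> operator_sphere sX V sY. norm (S x0) = 1 \<and> onorm_on V (\<lambda>x. S x - T x) < \<epsilon>))"

definition pointwise_BPB ::
    "('k \<Rightarrow> 'a::real_normed_vector \<Rightarrow> 'a) \<Rightarrow> 'a set \<Rightarrow>
     ('k \<Rightarrow> 'b::real_normed_vector \<Rightarrow> 'b) \<Rightarrow> bool" where
  "pointwise_BPB sX V sY \<longleftrightarrow> (\<forall>\<epsilon>>0. \<exists>\<eta>>0. pointwise_BPB_admissible sX V sY \<epsilon> \<eta>)"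

definition BPB_modulus ::
    "('k \<Rightarrow> 'a::real_normed_vector \<Rightarrow> 'a) \<Rightarrow> 'a set \<Rightarrow>
     ('k \<Rightarrow> 'b::real_normed_vector \<Rightarrow> 'b) \<Rightarrow> real \<Rightarrow> ennreal" where
  "BPB_modulus sX V sY \<epsilon> =
    Sup (insert 0 {ennreal \<rho> | \<rho>. \<rho> > 0 \<and> pointwise_BPB_admissible sX V sY \<epsilon> \<rho>})"

definition one_complemented :: "('k \<Rightarrow> 'a \<Rightarrow> 'a) \<Rightarrow> 'a::real_normed_vector set \<Rightarrow> bool" where
  "one_complemented sX V \<longleftrightarrow>
    (\<exists>P \<in> bounded_operators sX UNIV sX. P \<circ> P = P \<and> onorm P = 1 \<and> range P = V)"

text \<open>
  For the zero space the supremum below is taken over the empty set and has no meaning;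
  a space with a one-complemented subspace is never zero.
\<close>

definition modulus_of_smoothness :: "'a::real_normed_vector itself \<Rightarrow> real \<Rightarrow> real" where
  "modulus_of_smoothness _ t =
    Sup {(norm (x + y) + norm (x - y) - 2) / 2 | x y :: 'a. norm x = 1 \<and> norm y \<le> t}"

definition uniformly_smooth :: "'a::real_normed_vector itself \<Rightarrow> bool" where
  "uniformly_smooth X \<longleftrightarrow> ((\<lambda>t. modulus_of_smoothness X t / t) \<longlongrightarrow> 0) (at_right 0)"

end

theory Submission
  imports Defs
begin

text \<open>
  Let \<open>P\<close> be a norm-one projection onto \<open>X1\<close>. If \<open>T\<close> is an operator of norm one on \<open>X1\<close> almost
  attaining its norm at \<open>x0 \<in> X1\<close>, then \<open>T \<circ> P\<close> has norm one on the whole space and agrees with \<open>T\<close>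
  at \<open>x0\<close>. Restricting to \<open>X1\<close> an operator close to \<open>T \<circ> P\<close> that attains its norm at \<open>x0\<close> gives the
  required operator on \<open>X1\<close>, so every admissible \<open>\<rho>\<close> for the whole space is admissible for \<open>X1\<close>.
\<close>

text \<open>A real supremum can be compared with its elements only when the set is bounded above.
  The bound is \<open>\<bar>B\<bar>\<close> because \<open>B\<close> may be negative when
  \<open>V\<close> contains no nonzero vector, while the quotient at 0 is 0 by the convention for
  division by zero.\<close>

lemma bdd_above_norm_quotient:
  fixes T :: "'a::real_normed_vector \<Rightarrow> 'b::real_normed_vector"
  assumes "\<And>x. x \<in> V \<Longrightarrow> norm (T x) \<le> B * norm x"
  shows "bdd_above ((\<lambda>x. norm (T x) / norm x) ` V)"
proof (rule bdd_aboveI2)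
  fix x assume "x \<in> V"
  with assms[of x] show "norm (T x) / norm x \<le> \<bar>B\<bar>"
    by (cases "x = 0") (auto simp: divide_le_eq intro: order_trans mult_right_mono)
qed

lemma norm_le_onorm_on:
  fixes T :: "'a::real_normed_vector \<Rightarrow> 'b::real_normed_vector"
  assumes bound: "\<And>x. x \<in> V \<Longrightarrow> norm (T x) \<le> B * norm x" and "x \<in> V"
  shows "norm (T x) \<le> onorm_on V T * norm x"
proof (cases "x = 0")
  case True
  with assms show ?thesis by fastforce
next
  case False
  have "norm (T x) / norm x \<le> onorm_on V T"
    unfolding onorm_on_def
    by (rule cSUP_upper[OF \<open>x \<in> V\<close> bdd_above_norm_quotient[of V T B]]) (rule bound)
  with False show ?thesis by (simp add: divide_le_eq)
qed

text \<open>Nonnegativity of \<open>B\<close> handles the point 0, where the quotient takes the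
  default value 0.\<close>

lemma onorm_on_le:
  fixes T :: "'a::real_normed_vector \<Rightarrow> 'b::real_normed_vector"
  assumes "V \<noteq> {}" "0 \<le> B" "\<And>x. x \<in> V \<Longrightarrow> norm (T x) \<le> B * norm x"
  shows "onorm_on V T \<le> B"
  unfolding onorm_on_def
proof (rule cSUP_least[OF \<open>V \<noteq> {}\<close>])
  fix x assume "x \<in> V"
  with assms show "norm (T x) / norm x \<le> B"
    by (cases "x = 0") (auto simp: divide_le_eq)
qed

text \<open>The point 0 contributes the quotient 0, so the supremum cannot be negative.\<close>

lemma onorm_on_nonneg:
  fixes T :: "'a::real_normed_vector \<Rightarrow> 'b::real_normed_vector"
  assumes "\<And>x. x \<in> V \<Longrightarrow> norm (T x) \<le> B * norm x" "0 \<in> V"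
  shows "0 \<le> onorm_on V T"
  unfolding onorm_on_def
  by (rule cSUP_upper2[OF bdd_above_norm_quotient[of V T B] \<open>0 \<in> V\<close>]) (auto simp: assms(1))

lemma bounded_operators_boundE:
  assumes "T \<in> bounded_operators sX V sY"
  obtains B where "\<And>x. x \<in> V \<Longrightarrow> norm (T x) \<le> B * norm x"
  using assms unfolding bounded_operators_def by blast

lemma norm_le_operator_sphere:
  assumes "T \<in> operator_sphere sX V sY" "x \<in> V"
  shows "norm (T x) \<le> norm x"
proof -
  have "T \<in> bounded_operators sX V sY" "onorm_on V T = 1"
    using assms(1) by (auto simp: operator_sphere_def)
  then show ?thesis
    using norm_le_onorm_on[of V T _ x] assms(2) by (metis bounded_operators_boundE mult_1)
qed

lemma pointwise_BPB_admissible_one_complemented: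
  assumes "one_complemented sX V" and adm: "pointwise_BPB_admissible sX UNIV sY \<epsilon> \<rho>"
  shows "pointwise_BPB_admissible sX V sY \<epsilon> \<rho>"
  unfolding pointwise_BPB_admissible_def
proof (intro ballI impI)
  fix T x0
  assume T: "T \<in> operator_sphere sX V sY" and "x0 \<in> V"
    and x0: "norm x0 = 1 \<and> norm (T x0) > 1 - \<rho>"
  \<comment> \<open>Placing \<open>P\<close> in an operator sphere lets one contraction estimate
    serve \<open>P\<close>, \<open>T\<close> and later \<open>S\<close>.\<close>
  obtain P where P: "P \<in> operator_sphere sX UNIV sX" "P \<circ> P = P" "range P = V"
    using assms(1) by (auto simp: one_complemented_def operator_sphere_def onorm_on_UNIV)
  have P_lin: "P (x + y) = P x + P y" "P (sX c x) = sX c (P x)" for x y c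
    using P(1) by (auto simp: operator_sphere_def bounded_operators_def)
  have P_le: "norm (P x) \<le> norm x" for x
    using norm_le_operator_sphere[OF P(1)] by simp
  have P_in: "P x \<in> V" for x
    using P(3) by auto
  have P_id: "P v = v" if "v \<in> V" for v
    using that P(2,3) by (auto simp: fun_eq_iff)
  \<comment> \<open>\<open>V\<close> is known only as the range of \<open>P\<close>, that is, as its
    set of fixed points; by linearity of \<open>P\<close> these are closed under sums and scalar
    multiples.\<close>
  have V_add: "x + y \<in> V" if "x \<in> V" "y \<in> V" for x y
    using that P_in P_lin(1) P_id by metis
  have V_scale: "sX c x \<in> V" if "x \<in> V" for x c
    using that P_in P_lin(2) P_id by metis
  have "P 0 = 0"
    using P_le[of 0] by simp
  then have "0 \<in> V"
    using P_in[of 0] by simp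
  have T_add: "T (x + y) = T x + T y" if "x \<in> V" "y \<in> V" for x y
    using T that by (auto simp: operator_sphere_def bounded_operators_def)
  have T_scale: "T (sX c x) = sY c (T x)" if "x \<in> V" for x c
    using T that by (auto simp: operator_sphere_def bounded_operators_def)
  have T_le: "norm (T v) \<le> norm v" if "v \<in> V" for v
    using norm_le_operator_sphere[OF T that] .
  have TP_le: "norm (T (P x)) \<le> 1 * norm x" for x
    using order_trans[OF T_le[OF P_in] P_le] by simp
  \<comment> \<open>On \<open>V\<close> the composite agrees with \<open>T\<close>, so its norm is
    at least that of \<open>T\<close>; the reverse bound holds because \<open>P\<close> and
    \<open>T\<close> are contractions.\<close>
  have "onorm_on V T \<le> onorm_on UNIV (\<lambda>x. T (P x))"
  proof (rule onorm_on_le)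
    show "V \<noteq> {}" using \<open>0 \<in> V\<close> by auto
    show "0 \<le> onorm_on UNIV (\<lambda>x. T (P x))" by (rule onorm_on_nonneg[OF TP_le]) simp
    show "norm (T x) \<le> onorm_on UNIV (\<lambda>x. T (P x)) * norm x" if "x \<in> V" for x
      using norm_le_onorm_on[OF TP_le, of x UNIV] P_id[OF that] by simp
  qed
  moreover have "onorm_on UNIV (\<lambda>x. T (P x)) \<le> 1"
    by (rule onorm_on_le) (use TP_le in auto)
  ultimately have "onorm_on UNIV (\<lambda>x. T (P x)) = 1"
    using T by (simp add: operator_sphere_def)
  moreover have "(\<lambda>x. T (P x)) \<in> bounded_operators sX UNIV sY"
    using TP_le by (auto simp: bounded_operators_def P_lin T_add T_scale P_in intro!: exI[of _ 1])
  ultimately have "(\<lambda>x. T (P x)) \<in> operator_sphere sX UNIV sY"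
    by (simp add: operator_sphere_def)
  then obtain S where S: "S \<in> operator_sphere sX UNIV sY" "norm (S x0) = 1"
      "onorm_on UNIV (\<lambda>x. S x - T (P x)) < \<epsilon>"
    using adm x0 P_id[OF \<open>x0 \<in> V\<close>] unfolding pointwise_BPB_admissible_def by fastforce
  have S_le: "norm (S x) \<le> 1 * norm x" for x
    using norm_le_operator_sphere[OF S(1)] by simp
  \<comment> \<open>Operators on \<open>V\<close> are encoded as vanishing off \<open>V\<close>, so
    the restriction of \<open>S\<close> is extended by 0.\<close>
  define R where "R = (\<lambda>x. if x \<in> V then S x else 0)"
  have R_le: "norm (R x) \<le> 1 * norm x" for x
    using S_le by (simp add: R_def)
  have "R \<in> bounded_operators sX V sY"
    using S(1) V_add V_scale R_le
    by (auto simp: R_def operator_sphere_def bounded_operators_def)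
  moreover have "onorm_on V R = 1"
  proof (rule antisym)
    show "onorm_on V R \<le> 1"
      by (rule onorm_on_le) (use R_le \<open>0 \<in> V\<close> in auto)
    \<comment> \<open>The unit vector \<open>x0\<close> lies in \<open>V\<close> and
      \<open>R\<close> attains norm 1 there.\<close>
    show "1 \<le> onorm_on V R"
      using norm_le_onorm_on[OF R_le \<open>x0 \<in> V\<close>] \<open>x0 \<in> V\<close> S(2) x0 by (simp add: R_def)
  qed
  moreover have "onorm_on V (\<lambda>x. R x - T x) \<le> onorm_on UNIV (\<lambda>x. S x - T (P x))"
  proof (rule onorm_on_le)
    \<comment> \<open>The crude constant 2, from two contractions, only makes the supremum finite;
      the comparison itself rests on \<open>R x - T x = S x - T (P x)\<close> for \<open>x\<close>
      in \<open>V\<close>.\<close>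
    have D: "norm (S x - T (P x)) \<le> 2 * norm x" for x
      using norm_triangle_ineq4[of "S x" "T (P x)"] S_le[of x] TP_le[of x] by linarith
    show "V \<noteq> {}" using \<open>0 \<in> V\<close> by auto
    show "0 \<le> onorm_on UNIV (\<lambda>x. S x - T (P x))"
      by (rule onorm_on_nonneg[OF D]) simp
    show "norm (R x - T x) \<le> onorm_on UNIV (\<lambda>x. S x - T (P x)) * norm x" if "x \<in> V" for x
      using norm_le_onorm_on[OF D, of x UNIV] P_id[OF that] that
      by (simp add: R_def)
  qed
  ultimately show "\<exists>S\<in>operator_sphere sX V sY. norm (S x0) = 1 \<and> onorm_on V (\<lambda>x. S x - T x) < \<epsilon>"
    using S(2,3) \<open>x0 \<in> V\<close> by (intro bexI[of _ R]) (auto simp: R_def operator_sphere_def)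
qed

theorem proposition2p1:
  fixes sX :: "'k::real_or_complex \<Rightarrow> 'a::banach \<Rightarrow> 'a"
    and sY :: "'k \<Rightarrow> 'b::banach \<Rightarrow> 'b"
    and X1 :: "'a set"
  assumes "banach_over sX" and "banach_over sY"
    and "uniformly_smooth TYPE('a)"
    and "one_complemented sX X1"
  shows "(pointwise_BPB sX UNIV sY \<longrightarrow> pointwise_BPB sX X1 sY) \<and>
    (\<forall>\<epsilon>\<in>{0<..<1}. BPB_modulus sX UNIV sY \<epsilon> \<le> BPB_modulus sX X1 sY \<epsilon>)"
proof -
  note adm = pointwise_BPB_admissible_one_complemented[OF assms(4)]
  have "pointwise_BPB sX UNIV sY \<longrightarrow> pointwise_BPB sX X1 sY"
    unfolding pointwise_BPB_def using adm by blast
  \<comment> \<open>Every \<open>\<rho>\<close> admissible for the whole space is admissible for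
    \<open>X1\<close>, so the left supremum runs over a smaller set.\<close>
  moreover have "BPB_modulus sX UNIV sY \<epsilon> \<le> BPB_modulus sX X1 sY \<epsilon>" for \<epsilon>
    unfolding BPB_modulus_def by (rule Sup_subset_mono) (use adm in blast)
  ultimately show ?thesis by blast
qed

end
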